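(* Let $n\ge2$ and let $F:\mathcal S_n\to\mathbb R$ be any operator which is uniformly elliptic with constants $0<\lambda\le\Lambda$ and positively homogeneous of degree one (as in the context). Then its scaling exponent satisfies $$\frac{\lambda}{\Lambda}(n-1)-1\le\alpha^*(F)\le\frac{\Lambda}{\lambda}(n-1)-1.$$
   Context: $\mathcal S_n$ is the set of real symmetric $n\times n$ matrices. The map $F:\mathcal S_n\to\mathbb R$ satisfies, with constants $0<\lambda\le\Lambda$: (uniform ellipticity) $\lambda\,\mathrm{trace}(N)\le F(M-N)-F(M)\le\Lambda\,\mathrm{trace}(N)$ for all $M,N\in\mathcal S_n$ with $N$ nonnegative definite; (positive homogeneity) $F(tM)=tF(M)$ for all $t\ge0$ and $M\in\mathcal S_n$. All differential inequalities are understood in the viscosity sense. Spaces of homogeneous functions: for $\alpha\in[-1,\infty)\setminus\{0\}$, $H_\alpha^+$ is the set of $v\in C(\mathbb R^n\setminus\{0\})$ with $\alpha v>0$ and $\sigma^\alpha v(\sigma x)=v(x)$ for all $\sigma>0$, $x\ne0$. Scaling exponent: $\alpha^*(F):=\sup\{\alpha\in(-1,\infty)\setminus\{0\}:\text{there exists }v\in H_\alpha^+\text{ with }F(D^2v)\ge0\text{ in }\mathbb R^n\setminus\{0\}\}$. *)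

theory Defs
  imports "HOL-Analysis.Analysis"
begin

text \<open>Operators are total functions on all square matrices, but every condition below
  constrains them on symmetric matrices only.\<close>

definition symmetric_matrices :: "(real^'n^'n) set" where
  "symmetric_matrices = {M. transpose M = M}"

definition nonneg_definite :: "real^'n^'n \<Rightarrow> bool" where
  "nonneg_definite N \<longleftrightarrow> (\<forall>x. 0 \<le> x \<bullet> (N *v x))"

text \<open>With this sign convention the operator decreases in the matrix order; the model
  case is minus the trace.\<close>

definition uniformly_elliptic :: "real \<Rightarrow> real \<Rightarrow> (real^'n^'n \<Rightarrow> real) \<Rightarrow> bool" where
  "uniformly_elliptic lam Lam F \<longleftrightarrow>
     (\<forall>M\<in>symmetric_matrices. \<forall>N\<in>symmetric_matrices. nonneg_definite N \<longrightarrow>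
        lam * trace N \<le> F (M - N) - F M \<and> F (M - N) - F M \<le> Lam * trace N)"

definition positively_homogeneous :: "(real^'n^'n \<Rightarrow> real) \<Rightarrow> bool" where
  "positively_homogeneous F \<longleftrightarrow>
     (\<forall>t\<ge>0. \<forall>M\<in>symmetric_matrices. F (t *\<^sub>R M) = t * F M)"

text \<open>\<open>\<phi>\<close> is twice continuously differentiable on the open set \<open>\<Omega>\<close>, with gradient \<open>g\<close> and
  Hessian \<open>H\<close>. Symmetry of \<open>H\<close> is automatic.\<close>

definition C2_with :: "(real^'n) set \<Rightarrow> (real^'n \<Rightarrow> real) \<Rightarrow> (real^'n \<Rightarrow> real^'n)
    \<Rightarrow> (real^'n \<Rightarrow> real^'n^'n) \<Rightarrow> bool" where
  "C2_with \<Omega> \<phi> g H \<longleftrightarrow>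
     (\<forall>x\<in>\<Omega>. GDERIV \<phi> x :> g x) \<and>
     (\<forall>x\<in>\<Omega>. (g has_derivative (\<lambda>h. H x *v h)) (at x)) \<and>
     continuous_on \<Omega> H"

text \<open>\<open>F (D\<^sup>2 v) \<ge> 0\<close> in the open set \<open>\<Omega>\<close> in the viscosity sense. As \<open>F\<close> decreases in the
  Hessian, this is the supersolution property: test functions touch \<open>v\<close> from below,
  that is, \<open>v - \<phi>\<close> has a local minimum at the contact point.\<close>

definition viscosity_ge0 ::
  "(real^'n^'n \<Rightarrow> real) \<Rightarrow> (real^'n) set \<Rightarrow> (real^'n \<Rightarrow> real) \<Rightarrow> bool" where
  "viscosity_ge0 F \<Omega> v \<longleftrightarrow>
     (\<forall>x0\<in>\<Omega>. \<forall>\<phi> g H. C2_with \<Omega> \<phi> g H \<longrightarrow>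
        (\<forall>\<^sub>F y in at x0 within \<Omega>. v x0 - \<phi> x0 \<le> v y - \<phi> y) \<longrightarrow>
        0 \<le> F (H x0))"

text \<open>The value of such a function at the origin is irrelevant.\<close>

definition homog_pos :: "real \<Rightarrow> (real^'n \<Rightarrow> real) set" where
  "homog_pos \<alpha> = {v. continuous_on (- {0}) v \<and>
     (\<forall>x. x \<noteq> 0 \<longrightarrow> 0 < \<alpha> * v x) \<and>
     (\<forall>\<sigma>>0. \<forall>x. x \<noteq> 0 \<longrightarrow> \<sigma> powr \<alpha> * v (\<sigma> *\<^sub>R x) = v x)}"

text \<open>The supremum is taken in the extended reals, so that no nonemptiness or boundedness
  of the set of exponents is presupposed.\<close>

definition scaling_exponent :: "(real^'n^'n \<Rightarrow> real) \<Rightarrow> ereal" where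
  "scaling_exponent F =
     Sup (ereal ` {\<alpha>. -1 < \<alpha> \<and> \<alpha> \<noteq> 0 \<and> (\<exists>v\<in>homog_pos \<alpha>. viscosity_ge0 F (- {0}) v)})"

end

theory Submission
  imports Defs
begin

text \<open>The radial function \<open>sgn \<alpha> |x|\<^sup>-\<^sup>\<alpha>\<close> has, up to a positive factor, the Hessian with eigenvalue
  \<open>\<alpha> + 1\<close> in the radial direction and \<open>-1\<close> in the \<open>n - 1\<close> tangential ones. Ellipticity therefore
  gives \<open>\<lambda>(n - 1) - \<Lambda>(\<alpha> + 1) \<le> F \<le> \<Lambda>(n - 1) - \<lambda>(\<alpha> + 1)\<close> there. The lower bound makes this function
  an admissible supersolution as long as \<open>\<alpha> \<le> (\<lambda>/\<Lambda>)(n - 1) - 1\<close>. For the upper bound, a positive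
  supersolution \<open>v\<close> of homogeneity \<open>-\<alpha>\<close> is touched from below by \<open>m |x|\<^sup>-\<^sup>\<alpha>\<close>, with \<open>m\<close> the minimum of
  \<open>v\<close> on the unit sphere, so this multiple is itself a valid test function.\<close>

section \<open>Second derivatives\<close>

lemma GDERIV_imp_DERIV_line:
  assumes "GDERIV f (a + s *\<^sub>R u) :> D"
  shows "((\<lambda>s. f (a + s *\<^sub>R u)) has_real_derivative (u \<bullet> D)) (at s)"
proof -
  have "((\<lambda>s. a + s *\<^sub>R u) has_derivative (\<lambda>h. h *\<^sub>R u)) (at s)"
    by (auto intro!: derivative_eq_intros)
  from has_derivative_compose[OF this assms[unfolded gderiv_def]]
  show ?thesis
    by (simp add: has_field_derivative_def mult.commute[of _ "u \<bullet> D"])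
qed

text \<open>The left-hand side is symmetric in \<open>u\<close> and \<open>w\<close>, which forces the bilinear form on the right
  to be symmetric.\<close>

lemma second_difference_approx:
  fixes f :: "'a::real_inner \<Rightarrow> real"
  assumes "open S" "x \<in> S"
    and grad: "\<And>y. y \<in> S \<Longrightarrow> GDERIV f y :> g y"
    and A: "(g has_derivative A) (at x)"
    and "0 < e"
  shows "\<exists>d>0. \<forall>t. 0 < t \<and> t < d \<longrightarrow>
    \<bar>f (x + t *\<^sub>R u + t *\<^sub>R w) - f (x + t *\<^sub>R u) - f (x + t *\<^sub>R w) + f x - t\<^sup>2 * (u \<bullet> A w)\<bar> \<le> e * t\<^sup>2"
proof -
  interpret A: bounded_linear A
    using A by (rule has_derivative_bounded_linear)
  obtain r where r: "0 < r" "ball x r \<subseteq> S"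
    using assms(1,2) by (meson open_contains_ball)
  define K where "K = norm u + norm w"
  have K: "0 \<le> K" "norm u \<le> K" by (auto simp: K_def)
  \<comment> \<open>Paired with \<open>u\<close>, the two remainders of \<open>g\<close> contribute
    at most \<open>2 * e' * K\<^sup>2 * t\<close>. The divisor uses \<open>K + 1\<close> so that it
    stays positive when \<open>u\<close> and \<open>w\<close> both vanish.\<close>
  define e' where "e' = e / (2 * (K + 1)\<^sup>2)"
  have e': "0 < e'" using \<open>0 < e\<close> K by (simp add: e'_def)
  obtain d where d: "0 < d"
    "\<And>y. norm (y - x) < d \<Longrightarrow> norm (g y - g x - A (y - x)) \<le> e' * norm (y - x)"
    using A[unfolded has_derivative_at_alt] e' by blast
  define D where "D = min r d / (K + 1)"
  have "\<bar>f (x + t *\<^sub>R u + t *\<^sub>R w) - f (x + t *\<^sub>R u) - f (x + t *\<^sub>R w) + f x - t\<^sup>2 * (u \<bullet> A w)\<bar> \<le> e * t\<^sup>2"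
    if t: "0 < t" "t < D" for t
  proof -
    have tK: "t * (K + 1) < min r d"
      using t K by (simp add: D_def field_simps)
    have near: "norm (s *\<^sub>R u + q *\<^sub>R w) \<le> t * K" if "0 \<le> s" "s \<le> t" "0 \<le> q" "q \<le> t" for s q
    proof -
      have "norm (s *\<^sub>R u + q *\<^sub>R w) \<le> s * norm u + q * norm w"
        using that norm_triangle_ineq[of "s *\<^sub>R u" "q *\<^sub>R w"] by simp
      also have "\<dots> \<le> t * norm u + t * norm w"
        using that by (intro add_mono mult_right_mono) auto
      finally show ?thesis by (simp add: K_def distrib_left)
    qed
    have tK': "t * K < min r d" using tK t by (simp add: distrib_left)
    have inS: "x + s *\<^sub>R u + q *\<^sub>R w \<in> S" if "0 \<le> s" "s \<le> t" "0 \<le> q" "q \<le> t" for s q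
    proof -
      have "dist x (x + s *\<^sub>R u + q *\<^sub>R w) = norm (s *\<^sub>R u + q *\<^sub>R w)"
        by (metis add.assoc add_diff_cancel_left' dist_commute dist_norm)
      then show ?thesis using near[OF that] tK' r by (auto simp: subset_eq)
    qed
    \<comment> \<open>The second difference is the increment over \<open>[0, t]\<close>, along
      \<open>u\<close>, of the first difference \<open>p\<close> in direction \<open>w\<close>. One
      mean value step leaves a difference of gradients, to be expanded to first order at
      \<open>x\<close>.\<close>
    define p where "p s = f ((x + t *\<^sub>R w) + s *\<^sub>R u) - f (x + s *\<^sub>R u)" for s
    define p' where "p' s = u \<bullet> g ((x + t *\<^sub>R w) + s *\<^sub>R u) - u \<bullet> g (x + s *\<^sub>R u)" for s
    have "DERIV p s :> p' s" if "0 \<le> s" "s \<le> t" for s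
      unfolding p_def p'_def
      using inS[of s t] inS[of s 0] that t
      by (intro DERIV_diff GDERIV_imp_DERIV_line grad) (auto simp: algebra_simps)
    then obtain z where z: "0 < z" "z < t" "p t - p 0 = (t - 0) * p' z"
      using MVT2[of 0 t p p'] t by auto
    have rem: "norm (g (x + h) - g x - A h) \<le> e' * (t * K)" if "norm h \<le> t * K" for h
    proof -
      have "norm (g (x + h) - g x - A h) \<le> e' * norm h"
        using d(2)[of "x + h"] that tK' by simp
      also have "\<dots> \<le> e' * (t * K)" using that e' by (intro mult_left_mono) auto
      finally show ?thesis .
    qed
    let ?h1 = "z *\<^sub>R u + t *\<^sub>R w" and ?h2 = "z *\<^sub>R u"
    let ?R = "\<lambda>h. g (x + h) - g x - A h"
    have R: "norm (?R ?h1) \<le> e' * (t * K)" "norm (?R ?h2) \<le> e' * (t * K)"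
      using near[of z t] near[of z 0] z by (auto intro!: rem)
    \<comment> \<open>In the two expansions the values \<open>g x\<close> and the parts
      \<open>A (z *\<^sub>R u)\<close> cancel, so the unknown \<open>z\<close> drops out of the main
      term.\<close>
    have cancel: "a - c - (p + q) - (b - c - p) = a - b - q" for a b c p q :: 'a
      by simp
    have "?R ?h1 - ?R ?h2 = g (x + ?h1) - g (x + ?h2) - t *\<^sub>R A w"
      unfolding A.add A.scaleR by (rule cancel)
    moreover have "(x + t *\<^sub>R w) + z *\<^sub>R u = x + ?h1" by simp
    ultimately have "p' z - t * (u \<bullet> A w) = u \<bullet> (?R ?h1 - ?R ?h2)"
      by (simp only: p'_def inner_diff_right inner_scaleR_right)
    then have "\<bar>p' z - t * (u \<bullet> A w)\<bar> \<le> norm u * norm (?R ?h1 - ?R ?h2)"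
      by (metis Cauchy_Schwarz_ineq2)
    also have "\<dots> \<le> K * (2 * (e' * (t * K)))"
      using K R norm_triangle_ineq4[of "?R ?h1" "?R ?h2"] by (intro mult_mono) auto
    also have "\<dots> = (2 * e' * K\<^sup>2) * t"
      by (simp add: power2_eq_square)
    also have "\<dots> \<le> (2 * e' * (K + 1)\<^sup>2) * t"
      using e' t K by (intro mult_right_mono mult_left_mono power_mono) auto
    also have "2 * e' * (K + 1)\<^sup>2 = e"
      using K by (simp add: e'_def)
    finally have "t * \<bar>p' z - t * (u \<bullet> A w)\<bar> \<le> t * (e * t)"
      using t by (intro mult_left_mono) auto
    moreover have "f (x + t *\<^sub>R u + t *\<^sub>R w) - f (x + t *\<^sub>R u) - f (x + t *\<^sub>R w) + f x - t\<^sup>2 * (u \<bullet> A w)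
        = t * (p' z - t * (u \<bullet> A w))"
      using z(3) by (simp add: p_def algebra_simps power2_eq_square)
    ultimately show ?thesis
      using t by (simp add: abs_mult power2_eq_square mult_ac)
  qed
  moreover have "0 < D" using r d K by (simp add: D_def)
  ultimately show ?thesis by blast
qed

text \<open>Swapping \<open>u\<close> and \<open>w\<close> leaves the mixed difference unchanged, so
  both bilinear values, times \<open>t\<^sup>2\<close>, approximate one quantity up to
  \<open>e * t\<^sup>2\<close>. With \<open>e\<close> a third of the supposed gap, two such errors
  cannot bridge it.\<close>

lemma second_derivative_symmetric:
  fixes f :: "'a::real_inner \<Rightarrow> real"
  assumes "open S" "x \<in> S"
    and "\<And>y. y \<in> S \<Longrightarrow> GDERIV f y :> g y"
    and "(g has_derivative A) (at x)"
  shows "u \<bullet> A w = w \<bullet> A u"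
proof (rule ccontr)
  assume "u \<bullet> A w \<noteq> w \<bullet> A u"
  define e where "e = \<bar>u \<bullet> A w - w \<bullet> A u\<bar> / 3"
  have e: "0 < e" using \<open>u \<bullet> A w \<noteq> w \<bullet> A u\<close> by (simp add: e_def)
  obtain d1 where d1: "0 < d1" "\<And>t. 0 < t \<Longrightarrow> t < d1 \<Longrightarrow>
    \<bar>f (x + t *\<^sub>R u + t *\<^sub>R w) - f (x + t *\<^sub>R u) - f (x + t *\<^sub>R w) + f x - t\<^sup>2 * (u \<bullet> A w)\<bar> \<le> e * t\<^sup>2"
    using second_difference_approx[OF assms e] by metis
  obtain d2 where d2: "0 < d2" "\<And>t. 0 < t \<Longrightarrow> t < d2 \<Longrightarrow>
    \<bar>f (x + t *\<^sub>R w + t *\<^sub>R u) - f (x + t *\<^sub>R w) - f (x + t *\<^sub>R u) + f x - t\<^sup>2 * (w \<bullet> A u)\<bar> \<le> e * t\<^sup>2"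
    using second_difference_approx[OF assms e] by metis
  define t where "t = min d1 d2 / 2"
  have t: "0 < t" "t < d1" "t < d2" using d1(1) d2(1) by (auto simp: t_def)
  have "x + t *\<^sub>R w + t *\<^sub>R u = x + t *\<^sub>R u + t *\<^sub>R w" by simp
  then have "\<bar>t\<^sup>2 * (u \<bullet> A w) - t\<^sup>2 * (w \<bullet> A u)\<bar> \<le> 2 * (e * t\<^sup>2)"
    using d1(2)[OF t(1,2)] d2(2)[OF t(1,3)] by (simp only: abs_le_iff) linarith
  then have "t\<^sup>2 * \<bar>u \<bullet> A w - w \<bullet> A u\<bar> \<le> t\<^sup>2 * (2 * e)"
    by (simp add: abs_mult mult_ac flip: right_diff_distrib left_diff_distrib)
  then have "3 * e \<le> 2 * e" using t by (simp add: e_def)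
  then show False using e by simp
qed

text \<open>Along the line through \<open>x\<close> in direction \<open>u\<close> the slope vanishes
  at the minimum. A negative second derivative would make the slope negative just to the right, and
  the mean value theorem would then give a smaller value nearby.\<close>

lemma local_min_second_derivative_nonneg:
  fixes f :: "'a::real_inner \<Rightarrow> real"
  assumes "open S" "x \<in> S"
    and grad: "\<And>y. y \<in> S \<Longrightarrow> GDERIV f y :> g y"
    and A: "(g has_derivative A) (at x)"
    and min: "\<forall>\<^sub>F y in at x. f x \<le> f y"
  shows "0 \<le> u \<bullet> A u"
proof (rule ccontr)
  assume neg: "\<not> 0 \<le> u \<bullet> A u"
  interpret A: bounded_linear A
    using A by (rule has_derivative_bounded_linear)
  have u: "u \<noteq> 0" using neg by (auto simp: A.zero)
  obtain r where r: "0 < r" "ball x r \<subseteq> S"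
    using assms(1,2) by (meson open_contains_ball)
  obtain d where d: "0 < d" "\<And>y. dist y x < d \<Longrightarrow> f x \<le> f y"
    using min unfolding eventually_at by (metis dist_self order_refl UNIV_I)
  define \<delta> where "\<delta> = min r d / norm u"
  have \<delta>: "0 < \<delta>" using r d u by (simp add: \<delta>_def)
  define q where "q t = f (x + t *\<^sub>R u)" for t
  define q' where "q' t = u \<bullet> g (x + t *\<^sub>R u)" for t
  have near: "norm (t *\<^sub>R u) < min r d" if "\<bar>t\<bar> < \<delta>" for t
    using that u by (simp add: \<delta>_def field_simps)
  have q: "DERIV q t :> q' t" if "\<bar>t\<bar> < \<delta>" for t
    unfolding q_def q'_def using near[OF that] r
    by (intro GDERIV_imp_DERIV_line grad) (auto simp: subset_eq dist_norm)
  have qmin: "q 0 \<le> q t" if "\<bar>t\<bar> < \<delta>" for t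
    unfolding q_def using near[OF that] d by (auto simp: dist_norm)
  have "q' 0 = 0"
    using DERIV_local_min[OF q[of 0] \<delta>] qmin \<delta> by auto
  have "((\<lambda>t. x + t *\<^sub>R u) has_derivative (\<lambda>h. h *\<^sub>R u)) (at 0)"
    by (auto intro!: derivative_eq_intros)
  from has_derivative_compose[OF this, of g A] A
  have "((\<lambda>t. g (x + t *\<^sub>R u)) has_derivative (\<lambda>h. A (h *\<^sub>R u))) (at 0)" by simp
  then have "(q' has_derivative (\<lambda>h. u \<bullet> A (h *\<^sub>R u))) (at 0)"
    unfolding q'_def by (rule has_derivative_inner_right)
  then have "DERIV q' 0 :> u \<bullet> A u"
    by (simp add: has_field_derivative_def A.scaleR mult.commute[of _ "u \<bullet> A u"])
  then obtain d' where d': "0 < d'" "\<And>h. 0 < h \<Longrightarrow> h < d' \<Longrightarrow> q' h < 0"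
    using DERIV_neg_dec_right[of q' "u \<bullet> A u" 0] neg \<open>q' 0 = 0\<close> by auto
  define t where "t = min d' \<delta> / 2"
  have t: "0 < t" "t < d'" "t < \<delta>" using d' \<delta> by (auto simp: t_def)
  obtain z where "0 < z" "z < t" "q t - q 0 = (t - 0) * q' z"
    using MVT2[of 0 t q q'] q t by auto
  moreover have "q' z < 0" using d'(2)[of z] t calculation by simp
  ultimately have "q t < q 0"
    using t mult_pos_neg[of t "q' z"] by simp
  then show False using qmin[of t] t by simp
qed

section \<open>Symmetric Hessians; classical supersolutions are viscosity supersolutions\<close>

lemma symmetric_matrices_iff:
  fixes M :: "real^'n^'n"
  shows "M \<in> symmetric_matrices \<longleftrightarrow> (\<forall>u w. u \<bullet> (M *v w) = w \<bullet> (M *v u))"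
proof
  assume "M \<in> symmetric_matrices"
  then show "\<forall>u w. u \<bullet> (M *v w) = w \<bullet> (M *v u)"
    by (metis (mono_tags, lifting) dot_lmul_matrix inner_commute mem_Collect_eq
        symmetric_matrices_def transpose_matrix_vector)
next
  assume *: "\<forall>u w. u \<bullet> (M *v w) = w \<bullet> (M *v u)"
  have entry: "axis i 1 \<bullet> (M *v axis j 1) = M $ i $ j" for i j
    by (simp add: inner_axis' matrix_vector_mult_basis column_def)
  have "M $ i $ j = M $ j $ i" for i j
    using *[rule_format, of "axis i 1" "axis j 1"] by (simp only: entry)
  then show "M \<in> symmetric_matrices"
    by (simp add: symmetric_matrices_def transpose_def vec_eq_iff)
qed

text \<open>Ellipticity constrains \<open>F\<close> on symmetric matrices only, so Hessians have to
  be recognised as symmetric before it can be applied to them.\<close>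

lemma C2_with_symmetric:
  assumes "C2_with \<Omega> \<phi> g H" "open \<Omega>" "x \<in> \<Omega>"
  shows "H x \<in> symmetric_matrices"
  unfolding symmetric_matrices_iff
  using assms by (auto simp: C2_with_def intro!: second_derivative_symmetric[of \<Omega> x \<phi> g])

lemma trace_nonneg:
  fixes N :: "real^'n^'n"
  assumes "nonneg_definite N"
  shows "0 \<le> trace N"
proof -
  have "0 \<le> N $ i $ i" for i
    using assms[unfolded nonneg_definite_def, rule_format, of "axis i 1"]
    by (simp add: inner_axis' matrix_vector_mult_basis column_def)
  then show ?thesis by (simp add: trace_def sum_nonneg)
qed

text \<open>At a contact point \<open>v - \<phi>\<close> has a local minimum, so
  \<open>N = Hv x - H x\<close> is nonnegative definite. Since \<open>H x = Hv x - N\<close>,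
  ellipticity gives \<open>F (H x) \<ge> F (Hv x) + lam * trace N\<close>, a sum of nonnegative
  terms.\<close>

lemma classical_imp_viscosity_ge0:
  assumes "uniformly_elliptic lam Lam F" "0 \<le> lam" "open \<Omega>"
    and v: "C2_with \<Omega> v gv Hv"
    and pos: "\<And>x. x \<in> \<Omega> \<Longrightarrow> 0 \<le> F (Hv x)"
  shows "viscosity_ge0 F \<Omega> v"
  unfolding viscosity_ge0_def
proof (intro ballI allI impI)
  fix x \<phi> g H
  assume x: "x \<in> \<Omega>" and \<phi>: "C2_with \<Omega> \<phi> g H"
    and min: "\<forall>\<^sub>F y in at x within \<Omega>. v x - \<phi> x \<le> v y - \<phi> y"
  define N where "N = Hv x - H x"
  have sym: "Hv x \<in> symmetric_matrices" "H x \<in> symmetric_matrices"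
    using C2_with_symmetric v \<phi> \<open>open \<Omega>\<close> x by blast+
  then have symN: "N \<in> symmetric_matrices"
    by (auto simp: N_def symmetric_matrices_def transpose_def vec_eq_iff)
  have "0 \<le> u \<bullet> (N *v u)" for u
  proof (rule local_min_second_derivative_nonneg[OF \<open>open \<Omega>\<close> x])
    show "GDERIV (\<lambda>y. v y - \<phi> y) y :> gv y - g y" if "y \<in> \<Omega>" for y
      using that v \<phi> by (auto simp: C2_with_def intro: GDERIV_diff)
    show "((\<lambda>y. gv y - g y) has_derivative (\<lambda>h. N *v h)) (at x)"
      unfolding N_def matrix_vector_mult_diff_rdistrib
      using x v \<phi> by (auto simp: C2_with_def intro: has_derivative_diff)
    show "\<forall>\<^sub>F y in at x. v x - \<phi> x \<le> v y - \<phi> y"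
      using min at_within_open[OF x \<open>open \<Omega>\<close>] by simp
  qed
  then have psd: "nonneg_definite N" by (simp add: nonneg_definite_def)
  have "lam * trace N \<le> F (Hv x - N) - F (Hv x)"
    using assms(1) sym symN psd by (auto simp: uniformly_elliptic_def)
  moreover have "0 \<le> lam * trace N" using trace_nonneg[OF psd] \<open>0 \<le> lam\<close> by simp
  ultimately show "0 \<le> F (H x)" using pos[OF x] by (simp add: N_def)
qed

section \<open>Radial functions\<close>

text \<open>For a unit vector this is the orthogonal projection onto its span.\<close>

definition rank_one :: "real^'n \<Rightarrow> real^'n^'n" where
  "rank_one u = (\<chi> i j. u $ i * u $ j)"

lemma rank_one_mult_vec: "rank_one u *v w = (u \<bullet> w) *\<^sub>R u"
  by (simp add: rank_one_def vec_eq_iff matrix_vector_mult_def inner_vec_def sum_distrib_left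
      sum_distrib_right mult_ac)

lemma rank_one_symmetric: "rank_one u \<in> symmetric_matrices"
  by (simp add: symmetric_matrices_iff rank_one_mult_vec inner_commute)

lemma trace_rank_one: "trace (rank_one u) = (norm u)\<^sup>2"
  by (simp add: trace_def rank_one_def power2_norm_eq_inner inner_vec_def)

lemma trace_scaleR: "trace (c *\<^sub>R (M :: real^'n^'n)) = c * trace M"
  by (simp add: trace_def sum_distrib_left)

lemma symmetric_matrices_scaleR: "M \<in> symmetric_matrices \<Longrightarrow> c *\<^sub>R M \<in> symmetric_matrices"
  by (simp add: symmetric_matrices_def transpose_def vec_eq_iff)

lemma nonneg_definite_scaleR: "nonneg_definite N \<Longrightarrow> 0 \<le> c \<Longrightarrow> nonneg_definite (c *\<^sub>R N)"
  by (simp add: nonneg_definite_def flip: scaleR_matrix_vector_assoc)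

lemma nonneg_definite_rank_one: "nonneg_definite (rank_one u)"
  by (simp add: nonneg_definite_def rank_one_mult_vec inner_commute)

text \<open>The matrix projects orthogonally onto the hyperplane normal to \<open>u\<close>.
  Nonnegativity is Cauchy-Schwarz, and the trace is the dimension of that hyperplane.\<close>

lemma tangential_projection:
  fixes u :: "real^'n"
  assumes "norm u = 1"
  shows "mat 1 - rank_one u \<in> symmetric_matrices"
    and "nonneg_definite (mat 1 - rank_one u)"
    and "trace (mat 1 - rank_one u) = real CARD('n) - 1"
proof -
  show "mat 1 - rank_one u \<in> symmetric_matrices"
    by (simp add: symmetric_matrices_iff matrix_vector_mult_diff_rdistrib rank_one_mult_vec
        inner_diff_right inner_commute)
  have "(u \<bullet> w)\<^sup>2 \<le> w \<bullet> w" for w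
    using Cauchy_Schwarz_ineq[of u w] assms by (simp add: norm_eq_1)
  then show "nonneg_definite (mat 1 - rank_one u)"
    by (simp add: nonneg_definite_def matrix_vector_mult_diff_rdistrib rank_one_mult_vec
        inner_diff_right inner_commute power2_eq_square)
  show "trace (mat 1 - rank_one u) = real CARD('n) - 1"
    using assms by (simp add: trace_sub trace_I trace_rank_one)
qed

lemma elliptic_radial_bounds:
  fixes F :: "real^'n^'n \<Rightarrow> real"
  assumes ell: "uniformly_elliptic lam Lam F" and "F 0 = 0"
    and u: "norm u = 1" and "0 \<le> p" "0 \<le> q"
  defines "X \<equiv> p *\<^sub>R rank_one u - q *\<^sub>R (mat 1 - rank_one u)"
  shows "lam * (q * (real CARD('n) - 1)) - Lam * p \<le> F X"
    and "F X \<le> Lam * (q * (real CARD('n) - 1)) - lam * p"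
proof -
  note T = tangential_projection[OF u]
  let ?P = "p *\<^sub>R rank_one u" and ?N = "q *\<^sub>R (mat 1 - rank_one u)"
  have P: "?P \<in> symmetric_matrices" "nonneg_definite ?P" "trace ?P = p"
    using u \<open>0 \<le> p\<close>
    by (auto intro: symmetric_matrices_scaleR rank_one_symmetric nonneg_definite_scaleR
        nonneg_definite_rank_one simp: trace_scaleR trace_rank_one)
  have N: "?N \<in> symmetric_matrices" "nonneg_definite ?N" "trace ?N = q * (real CARD('n) - 1)"
    using T \<open>0 \<le> q\<close>
    by (auto intro: symmetric_matrices_scaleR nonneg_definite_scaleR simp: trace_scaleR)
  \<comment> \<open>The pair \<open>(?P, ?P)\<close> confines \<open>- F ?P\<close> to the interval
    from \<open>lam * p\<close> to \<open>Lam * p\<close>, because \<open>F 0 = 0\<close>; the pair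
    \<open>(?P, ?N)\<close> bounds the change from \<open>F ?P\<close> to
    \<open>F X\<close>.\<close>
  have "lam * trace ?P \<le> F (?P - ?P) - F ?P" "F (?P - ?P) - F ?P \<le> Lam * trace ?P"
       "lam * trace ?N \<le> F (?P - ?N) - F ?P" "F (?P - ?N) - F ?P \<le> Lam * trace ?N"
    using ell P(1,2) N(1,2) unfolding uniformly_elliptic_def by blast+
  then show "lam * (q * (real CARD('n) - 1)) - Lam * p \<le> F X"
    "F X \<le> Lam * (q * (real CARD('n) - 1)) - lam * p"
    unfolding P(3) N(3) X_def using \<open>F 0 = 0\<close> by auto
qed

text \<open>The Hessian of \<open>c * norm x powr b\<close> in spectral form: the bracket has
  eigenvalue \<open>b - 1\<close> in the radial direction and \<open>1\<close> in the tangential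
  ones.\<close>

definition radial_hessian :: "real \<Rightarrow> real \<Rightarrow> real^'n \<Rightarrow> real^'n^'n" where
  "radial_hessian c b x = (c * b * norm x powr (b - 2)) *\<^sub>R (mat 1 + (b - 2) *\<^sub>R rank_one (sgn x))"

text \<open>The gradient is a multiple of \<open>x\<close> rather than of \<open>sgn x\<close>, so
  that the second derivative is a product rule whose scalar factor is again a power of the
  norm.\<close>

lemma GDERIV_norm_powr:
  assumes "(x::real^'n) \<noteq> 0"
  shows "GDERIV (\<lambda>x. norm x powr b) x :> (b * norm x powr (b - 2)) *\<^sub>R x"
proof -
  have "DERIV (\<lambda>r. r powr b) (norm x) :> b * norm x powr (b - 1)"
    using assms by (intro has_real_derivative_powr) auto
  from GDERIV_DERIV_compose[OF GDERIV_norm[OF assms] this]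
  have "GDERIV (\<lambda>x. norm x powr b) x :> (b * norm x powr (b - 1)) *\<^sub>R sgn x" .
  moreover have "norm x powr (b - 1) = norm x powr (b - 2) * norm x"
    using assms powr_add[of "norm x" "b - 2" 1] by simp
  moreover have "sgn x = (1 / norm x) *\<^sub>R x"
    by (simp add: sgn_div_norm divide_inverse)
  ultimately show ?thesis
    using assms by simp
qed

lemma C2_with_radial:
  "C2_with (- {0}) (\<lambda>x. c * norm x powr b) (\<lambda>x. (c * b * norm x powr (b - 2)) *\<^sub>R x)
     (radial_hessian c b :: real^'n \<Rightarrow> real^'n^'n)"
  unfolding C2_with_def
proof (intro conjI ballI)
  fix x :: "real^'n" assume "x \<in> - {0}"
  then have x: "x \<noteq> 0" by simp
  have "((\<lambda>x. c * norm x powr b) has_derivative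
      (\<lambda>h. c * (h \<bullet> ((b * norm x powr (b - 2)) *\<^sub>R x)))) (at x)"
    using GDERIV_norm_powr[OF x, of b] unfolding gderiv_def by (rule has_derivative_mult_right)
  then show "GDERIV (\<lambda>x. c * norm x powr b) x :> (c * b * norm x powr (b - 2)) *\<^sub>R x"
    by (simp add: gderiv_def mult_ac)
  have "((\<lambda>x. (c * b * norm x powr (b - 2)) *\<^sub>R x) has_derivative
      (\<lambda>h. (c * b * norm x powr (b - 2)) *\<^sub>R h
         + (c * b * (h \<bullet> (((b - 2) * norm x powr (b - 2 - 2)) *\<^sub>R x))) *\<^sub>R x)) (at x)" (is ?D)
    using GDERIV_norm_powr[OF x, of "b - 2"] unfolding gderiv_def
    by (intro has_derivative_scaleR has_derivative_mult_right has_derivative_ident)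
  \<comment> \<open>Moving two powers of the norm onto \<open>x\<close> turns the outer product of
    \<open>x\<close> with itself into the projection \<open>rank_one (sgn x)\<close>.\<close>
  have "norm x powr (b - 2) = norm x powr (b - 2 - 2) * (norm x)\<^sup>2"
    using x powr_add[of "norm x" "b - 2 - 2" 2] by simp
  moreover have sgn_eq: "sgn x = (1 / norm x) *\<^sub>R x"
    by (simp add: sgn_div_norm divide_inverse)
  ultimately have "(c * b * norm x powr (b - 2)) *\<^sub>R h
         + (c * b * (h \<bullet> (((b - 2) * norm x powr (b - 2 - 2)) *\<^sub>R x))) *\<^sub>R x
      = radial_hessian c b x *v h" for h
    using x
    by (simp add: radial_hessian_def matrix_vector_mult_add_rdistrib rank_one_mult_vec
        sgn_eq scaleR_add_right inner_commute power2_eq_square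
        flip: scaleR_matrix_vector_assoc)
  with \<open>?D\<close> show "((\<lambda>x. (c * b * norm x powr (b - 2)) *\<^sub>R x) has_derivative
      (\<lambda>h. radial_hessian c b x *v h)) (at x)" by simp
next
  have "continuous_on (- {0}) (\<lambda>x::real^'n. rank_one (sgn x))"
    unfolding rank_one_def
    by (intro continuous_on_vec_lambda continuous_intros) auto
  then show "continuous_on (- {0}) (radial_hessian c b :: real^'n \<Rightarrow> real^'n^'n)"
    unfolding radial_hessian_def by (intro continuous_intros) auto
qed

text \<open>For exponent \<open>- a\<close> the prefactor is \<open>- k\<close> and the radial
  eigenvalue of the bracket is \<open>- a - 1\<close>; the two signs combine to
  \<open>k * (a + 1)\<close>.\<close>

lemma radial_hessian_split:
  "radial_hessian c (- a) x =
     (k * (a + 1)) *\<^sub>R rank_one (sgn x) - k *\<^sub>R (mat 1 - rank_one (sgn x))"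
  if "k = c * a * norm x powr (- a - 2)"
  by (simp add: that radial_hessian_def algebra_simps flip: scaleR_add_left mult_2)

text \<open>The sufficient condition serves the lower bound on the exponent, the necessary one the
  upper bound. Here \<open>0 < c * a\<close> makes the common factor \<open>k\<close> positive, so
  it divides out, and \<open>-1 < a\<close> makes the radial coefficient nonnegative.\<close>

lemma radial_hessian_bounds:
  fixes F :: "real^'n^'n \<Rightarrow> real"
  assumes "uniformly_elliptic lam Lam F" "F 0 = 0"
    and "x \<noteq> 0" "-1 < a" "0 < c * a"
  shows "0 \<le> lam * (real CARD('n) - 1) - Lam * (a + 1) \<Longrightarrow> 0 \<le> F (radial_hessian c (- a) x)"
    and "0 \<le> F (radial_hessian c (- a) x) \<Longrightarrow> 0 \<le> Lam * (real CARD('n) - 1) - lam * (a + 1)"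
proof -
  define k where "k = c * a * norm x powr (- a - 2)"
  have k: "0 < k" using assms by (simp add: k_def)
  have u: "norm (sgn x) = 1" using \<open>x \<noteq> 0\<close> by (simp add: norm_sgn)
  have p: "0 \<le> k * (a + 1)" using k \<open>-1 < a\<close> by simp
  note B = elliptic_radial_bounds[OF assms(1,2) u p less_imp_le[OF k],
      folded radial_hessian_split[OF k_def]]
  show "0 \<le> F (radial_hessian c (- a) x)" if "0 \<le> lam * (real CARD('n) - 1) - Lam * (a + 1)"
  proof -
    have "0 \<le> k * (lam * (real CARD('n) - 1) - Lam * (a + 1))" using that k by simp
    then show ?thesis using B(1) by (simp add: algebra_simps)
  qed
  show "0 \<le> Lam * (real CARD('n) - 1) - lam * (a + 1)" if "0 \<le> F (radial_hessian c (- a) x)"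
  proof -
    have "0 \<le> k * (Lam * (real CARD('n) - 1) - lam * (a + 1))"
      using B(2) that by (simp add: algebra_simps)
    then show ?thesis using k by (simp add: zero_le_mult_iff)
  qed
qed

section \<open>Radial powers among the homogeneous functions\<close>

lemma radial_homog_pos:
  assumes "a \<noteq> 0"
  shows "(\<lambda>x::real^'n. sgn a * norm x powr (- a)) \<in> homog_pos a"
proof -
  have "continuous_on (- {0}) (\<lambda>x::real^'n. sgn a * norm x powr (- a))"
    by (intro continuous_intros) auto
  \<comment> \<open>The factor \<open>sgn a\<close> gives the required sign for negative exponents
    as well.\<close>
  moreover have "0 < a * (sgn a * norm x powr (- a))" if "x \<noteq> 0" for x :: "real^'n"
    using that assms by (simp flip: mult.assoc add: zero_less_mult_iff sgn_if)
  moreover have "s powr a * (sgn a * norm (s *\<^sub>R x) powr (- a)) = sgn a * norm x powr (- a)"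
    if "0 < s" for s and x :: "real^'n"
    using that by (simp add: powr_mult powr_minus)
  ultimately show ?thesis by (simp add: homog_pos_def)
qed

text \<open>The ratio of \<open>v\<close> to the radial power is constant on rays, so its minimum is
  that of \<open>v\<close> over the compact unit sphere and is attained. The assumption
  \<open>0 < a\<close> makes \<open>v\<close>, hence \<open>m\<close>, positive.\<close>

lemma homog_pos_touched_by_radial:
  fixes v :: "real^'n \<Rightarrow> real"
  assumes v: "v \<in> homog_pos a" and "0 < a"
  obtains m x0 where "0 < m" "x0 \<noteq> 0" "v x0 = m * norm x0 powr (- a)"
    "\<And>x. x \<noteq> 0 \<Longrightarrow> m * norm x powr (- a) \<le> v x"
proof -
  have cont: "continuous_on (- {0}) v" and pos: "\<And>x. x \<noteq> 0 \<Longrightarrow> 0 < v x"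
    and hom: "\<And>s x. 0 < s \<Longrightarrow> x \<noteq> 0 \<Longrightarrow> s powr a * v (s *\<^sub>R x) = v x"
    using v \<open>0 < a\<close> by (auto simp: homog_pos_def zero_less_mult_iff)
  have "sphere (0::real^'n) 1 \<noteq> {}" by simp
  moreover have "continuous_on (sphere 0 1) v"
    using cont by (rule continuous_on_subset) auto
  ultimately obtain x0 where x0: "x0 \<in> sphere 0 1" "\<And>y. y \<in> sphere 0 1 \<Longrightarrow> v x0 \<le> v y"
    using continuous_attains_inf[OF compact_sphere] by metis
  have nz: "x0 \<noteq> 0" using x0 by auto
  have "v x0 * norm x powr (- a) \<le> v x" if "x \<noteq> 0" for x
  proof -
    have "v x0 \<le> v (sgn x)" using that by (intro x0) (simp add: norm_sgn)
    moreover have "v (sgn x) = norm x powr a * v x"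
      using hom[of "norm x" "sgn x"] that
      by (simp add: sgn_div_norm)
    ultimately have "v x0 * norm x powr (- a) \<le> norm x powr a * v x * norm x powr (- a)"
      by (intro mult_right_mono) auto
    also have "\<dots> = v x" using that by (simp add: powr_minus)
    finally show ?thesis .
  qed
  then show ?thesis using that[of "v x0" x0] nz pos[OF nz] x0(1) by simp
qed

section \<open>Bounds on the scaling exponent\<close>

theorem corollary3p6:
  fixes F :: "real^'n^'n \<Rightarrow> real" and lam Lam :: real
  assumes "CARD('n) \<ge> 2"
    and "0 < lam" and "lam \<le> Lam"
    and "uniformly_elliptic lam Lam F"
    and "positively_homogeneous F"
  shows "ereal (lam / Lam * (real CARD('n) - 1) - 1) \<le> scaling_exponent F \<and>
         scaling_exponent F \<le> ereal (Lam / lam * (real CARD('n) - 1) - 1)"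
proof
  have Lam: "0 < Lam" using assms by simp
  have "(0 :: real^'n^'n) \<in> symmetric_matrices"
    by (simp add: symmetric_matrices_def transpose_def vec_eq_iff)
  \<comment> \<open>Ellipticity controls differences of \<open>F\<close> only; homogeneity with
    \<open>t = 0\<close> fixes the base value.\<close>
  then have F0: "F 0 = 0"
    using assms(5) unfolding positively_homogeneous_def
    by (metis mult_zero_left order_refl scaleR_zero_left)
  \<comment> \<open>From here on \<open>n\<close> is the number of tangential directions, one less
    than the dimension.\<close>
  define n where "n = real CARD('n) - 1"
  have n: "1 \<le> n" using assms(1) by (simp add: n_def)
  define \<beta> where "\<beta> = lam / Lam * n - 1"
  have \<beta>: "-1 < \<beta>" using assms Lam n by (simp add: \<beta>_def)
  \<comment> \<open>All admissible exponents up to \<open>\<beta>\<close> are treated, since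
    \<open>\<beta>\<close> itself may be the excluded value \<open>0\<close>.\<close>
  have lower: "ereal a \<le> scaling_exponent F" if a: "-1 < a" "a \<noteq> 0" "a \<le> \<beta>" for a
  proof -
    have "Lam * (a + 1) \<le> Lam * (lam / Lam * n)"
      using a Lam by (intro mult_left_mono) (auto simp: \<beta>_def)
    then have le: "0 \<le> lam * n - Lam * (a + 1)" using Lam by simp
    have "viscosity_ge0 F (- {0}) (\<lambda>x. sgn a * norm x powr (- a))"
    proof (rule classical_imp_viscosity_ge0[OF assms(4) _ _ C2_with_radial])
      fix x :: "real^'n" assume "x \<in> - {0}"
      then show "0 \<le> F (radial_hessian (sgn a) (- a) x)"
        using a le unfolding n_def
        by (intro radial_hessian_bounds(1)[OF assms(4) F0]) (auto simp: sgn_if)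
    qed (use \<open>0 < lam\<close> in auto)
    with a radial_homog_pos[OF a(2)] show ?thesis
      unfolding scaling_exponent_def by (intro Sup_upper) blast
  qed
  have "ereal \<beta> \<le> scaling_exponent F"
  proof (cases "\<beta> = 0")
    case False
    then show ?thesis using lower \<beta> by simp
  next
    case True
    \<comment> \<open>The exponent \<open>0\<close> is not in the set, so the supremum is approached
      through negative exponents \<open>w\<close> above \<open>-1\<close>.\<close>
    have "ereal 0 \<le> scaling_exponent F"
    proof (rule dense_le_bounded[of "ereal (-1)"])
      fix w assume "ereal (-1) < w" "w < ereal 0"
      then show "w \<le> scaling_exponent F"
        using True by (cases w) (auto intro: lower)
    qed simp
    with True show ?thesis by simp
  qed
  then show "ereal (lam / Lam * (real CARD('n) - 1) - 1) \<le> scaling_exponent F"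
    by (simp add: \<beta>_def n_def)
  show "scaling_exponent F \<le> ereal (Lam / lam * (real CARD('n) - 1) - 1)"
    unfolding scaling_exponent_def n_def[symmetric]
  proof (rule Sup_least, clarify)
    fix a and v :: "real^'n \<Rightarrow> real"
    assume a: "-1 < a" "a \<noteq> 0" and v: "v \<in> homog_pos a" and visc: "viscosity_ge0 F (- {0}) v"
    have "a \<le> Lam / lam * n - 1"
    proof (cases "0 < a")
      case False
      \<comment> \<open>For negative exponents the bound holds because its right-hand side is
        nonnegative: both \<open>Lam / lam\<close> and \<open>n\<close> are at least
        \<open>1\<close>.\<close>
      have "1 * 1 \<le> Lam / lam * n" using assms(2,3) n by (intro mult_mono) auto
      then show ?thesis using False by simp
    next
      case True
      obtain m x0 where m: "0 < m" and x0: "x0 \<noteq> 0" "v x0 = m * norm x0 powr (- a)"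
        and below: "\<And>x. x \<noteq> 0 \<Longrightarrow> m * norm x powr (- a) \<le> v x"
        using homog_pos_touched_by_radial[OF v True] by blast
      \<comment> \<open>The left side is zero by contact at \<open>x0\<close> and the right side is
        nonnegative away from the origin, so the radial power is a valid test function.\<close>
      have "\<forall>\<^sub>F y in at x0 within - {0}.
          v x0 - m * norm x0 powr (- a) \<le> v y - m * norm y powr (- a)"
        using x0 below by (auto simp: eventually_at_filter)
      then have "0 \<le> F (radial_hessian m (- a) x0)"
        using visc[unfolded viscosity_ge0_def, rule_format,
            OF _ C2_with_radial[of m "- a"]] x0(1) by auto
      then have "0 \<le> Lam * n - lam * (a + 1)"
        using radial_hessian_bounds(2)[OF assms(4) F0 x0(1) a(1), of m] m True
        by (simp add: n_def)
      then show ?thesis using assms(2) by (simp add: field_simps)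
    qed
    then show "ereal a \<le> ereal (Lam / lam * n - 1)" by simp
  qed
qed

end
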